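(* Let $m$ be a positive integer and let $\Delta$ be a simplicial complex on $[m]$. Then the image of $\phi_\Delta$ is a convex cone. The matrices on the extreme rays of the image (that is, the non-zero matrices spanning extreme rays) are exactly the rank one matrices that belong to $\mathbb{S}^m_{\succeq 0}(F)$ for some face $F\in\Delta$. In other words, $\operatorname{im}(\phi_\Delta)=\sum_{F\in\Delta}\mathbb{S}^m_{\succeq 0}(F)$ (Minkowski sum).
   Context: Notation: $[m]=\{1,\dots,m\}$. A simplicial complex on $[m]$ is a collection $\Delta\subseteq 2^{[m]}$ closed under taking subsets, whose union of faces is $[m]$ (so all singletons are faces); its elements are called faces. $\mathbb{S}^m_{\succeq 0}$ is the convex cone of real symmetric positive semidefinite $m\times m$ matrices. For $F\subseteq[m]$, $\mathbb{S}^m_{\succeq 0}(F)$ is the convex cone of matrices in $\mathbb{S}^m_{\succeq 0}$ all of whose entries outside the $F\times F$ submatrix are zero. The map $\phi_\Delta:\prod_{F\in\Delta}\mathbb{R}^{|F|}\to\mathbb{S}^m_{\succeq 0}$ is defined by $\phi_\Delta(\gamma)=\Gamma(\gamma)\Gamma(\gamma)^T$, where for $\gamma=(\gamma_{i,F}: F\in\Delta,\ i\in F)$ the $[m]\times\Delta$ matrix $\Gamma(\gamma)$ has entries $\Gamma(\gamma)_{i,F}=\gamma_{i,F}$ if $i\in F$ and $0$ otherwise. Thus $\phi_\Delta(\gamma)_{ij}=\sum_{F\in\Delta:\, i,j\in F}\gamma_{i,F}\gamma_{j,F}$. A ray of a convex cone is the set of non-negative scalar multiples of a non-zero element of the cone;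 an extreme ray is a ray that cannot be written as a positive linear combination of two distinct rays of the cone. *)

theory Defs
  imports "HOL-Analysis.Analysis"
begin

text \<open>
  The vertex set \<open>[m]\<close> is rendered as an arbitrary finite type \<open>'m\<close> with \<open>m = CARD('m)\<close>; since types
  are non-empty, \<open>m\<close> is positive.
\<close>

definition abstract_simplicial_complex :: "'m::finite set set \<Rightarrow> bool" where
  "abstract_simplicial_complex \<Delta> \<longleftrightarrow> (\<forall>F\<in>\<Delta>. \<forall>G. G \<subseteq> F \<longrightarrow> G \<in> \<Delta>) \<and> \<Union>\<Delta> = UNIV"

definition psd_cone :: "(real^'m^'m::finite) set" where
  "psd_cone = {A. transpose A = A \<and> (\<forall>x. 0 \<le> x \<bullet> (A *v x))}"

definition psd_cone_on :: "'m::finite set \<Rightarrow> (real^'m^'m) set" where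
  "psd_cone_on F = {A \<in> psd_cone. \<forall>i j. \<not> (i \<in> F \<and> j \<in> F) \<longrightarrow> A $ i $ j = 0}"

text \<open>
  A point \<open>\<gamma>\<close> of \<open>\<Prod>\<^sub>F \<real>\<^sup>F\<close> stores the coordinate \<open>\<gamma>\<^sub>i\<^sub>,\<^sub>F\<close> as \<open>\<gamma> F i\<close>; coordinates outside
  \<open>i \<in> F \<in> \<Delta>\<close> are fixed to \<open>undefined\<close> by the extensional function spaces.
\<close>

definition params :: "'m::finite set set \<Rightarrow> ('m set \<Rightarrow> 'm \<Rightarrow> real) set" where
  "params \<Delta> = (\<Pi>\<^sub>E F\<in>\<Delta>. (F \<rightarrow>\<^sub>E UNIV))"

text \<open>
  The columns of \<open>\<Gamma>(\<gamma>)\<close> are indexed by the finite type of all subsets of the vertex set; the columns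
  of non-faces are zero, so they do not contribute to \<open>\<Gamma>(\<gamma>)\<Gamma>(\<gamma>)\<^sup>T\<close>.
\<close>

definition Gamma_mat :: "'m::finite set set \<Rightarrow> ('m set \<Rightarrow> 'm \<Rightarrow> real) \<Rightarrow> real^('m set)^'m" where
  "Gamma_mat \<Delta> \<gamma> = (\<chi> i F. if F \<in> \<Delta> \<and> i \<in> F then \<gamma> F i else 0)"

definition phi :: "'m::finite set set \<Rightarrow> ('m set \<Rightarrow> 'm \<Rightarrow> real) \<Rightarrow> real^'m^'m" where
  "phi \<Delta> \<gamma> = Gamma_mat \<Delta> \<gamma> ** transpose (Gamma_mat \<Delta> \<gamma>)"

lemma phi_nth:
  "phi \<Delta> \<gamma> $ i $ j = (\<Sum>F | F \<in> \<Delta> \<and> i \<in> F \<and> j \<in> F. \<gamma> F i * \<gamma> F j)"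
proof -
  have "phi \<Delta> \<gamma> $ i $ j =
      (\<Sum>F\<in>UNIV. if F \<in> \<Delta> \<and> i \<in> F \<and> j \<in> F then \<gamma> F i * \<gamma> F j else 0)"
    unfolding phi_def Gamma_mat_def matrix_matrix_mult_def transpose_def
    by (auto intro!: sum.cong)
  then show ?thesis
    by (simp add: sum.If_cases)
qed

lemma phi_in_psd_cone: "phi \<Delta> \<gamma> \<in> psd_cone"
proof -
  let ?G = "Gamma_mat \<Delta> \<gamma>"
  have "0 \<le> x \<bullet> (phi \<Delta> \<gamma> *v x)" for x
  proof -
    have "x \<bullet> (phi \<Delta> \<gamma> *v x) = (transpose ?G *v x) \<bullet> (transpose ?G *v x)"
      unfolding phi_def
      by (simp add: matrix_vector_mul_assoc[symmetric] dot_lmul_matrix[symmetric])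
    then show ?thesis by simp
  qed
  then show ?thesis
    by (simp add: psd_cone_def phi_def matrix_transpose_mul)
qed

definition ray :: "'a::real_vector \<Rightarrow> 'a set" where
  "ray x = {c *\<^sub>R x | c. 0 \<le> c}"

definition rays_of :: "'a::real_vector set \<Rightarrow> 'a set set" where
  "rays_of C = ray ` (C - {0})"

text \<open>
  A ray is a positive linear combination of two rays if it is spanned by \<open>a *\<^sub>R x + b *\<^sub>R y\<close> for some
  spanning vectors \<open>x\<close>, \<open>y\<close> of these rays and some \<open>a, b > 0\<close> (this is not the Minkowski sum of
  the two rays as sets).
\<close>

definition extreme_ray_of :: "'a::real_vector set \<Rightarrow> 'a set \<Rightarrow> bool" where
  "extreme_ray_of C R \<longleftrightarrow> R \<in> rays_of C \<and>
     \<not> (\<exists>x\<in>C - {0}. \<exists>y\<in>C - {0}. ray x \<noteq> ray y \<and>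
          (\<exists>a>0. \<exists>b>0. R = ray (a *\<^sub>R x + b *\<^sub>R y)))"

end

theory Submission
  imports Defs
begin

text \<open>
  A positive semidefinite matrix supported on \<open>F\<close> is, for any \<open>x \<in> F\<close>, the sum of a square
  \<open>v v\<^sup>T\<close> with \<open>v\<close> supported on \<open>F\<close> and a positive semidefinite matrix supported on \<open>F - {x}\<close>
  (a Schur complement). Removing the faces of \<open>\<Delta>\<close> one at a time, each maximal among those that
  remain, and moving the Schur complement to the smaller face \<open>F - {x}\<close>, one turns a sum of
  positive semidefinite matrices supported on faces into a sum with a single square per face,
  that is, into a point of the image. The image is thus the Minkowski sum, hence a convex cone.
  It is spanned by squares, so its extreme rays have rank one; conversely, a rank one
  positive semidefinite matrix dominates only its own multiples.
\<close>

section \<open>Squares of vectors\<close>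

definition outer_square :: "real^'m \<Rightarrow> real^'m^'m::finite" where
  "outer_square v = (\<chi> i j. v $ i * v $ j)"

lemma outer_square_nth [simp]: "outer_square v $ i $ j = v $ i * v $ j"
  by (simp add: outer_square_def)

lemma outer_square_mult_vec: "outer_square v *v x = (v \<bullet> x) *\<^sub>R v"
  by (simp add: vec_eq_iff matrix_vector_mult_def inner_vec_def sum_distrib_left mult.assoc
      mult.left_commute mult.commute)

lemma outer_square_eq_0_iff: "outer_square v = 0 \<longleftrightarrow> v = 0"
  by (auto simp: vec_eq_iff)

lemma outer_square_scaleR: "outer_square (c *\<^sub>R v) = c\<^sup>2 *\<^sub>R outer_square v"
  by (simp add: vec_eq_iff power2_eq_square mult_ac)

lemma rank_outer_square:
  assumes "v \<noteq> 0"
  shows "rank (outer_square v) = 1"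
proof -
  have "range (\<lambda>x. outer_square v *v x) = span {v}"
  proof -
    \<comment> \<open>The preimage \<open>(c / (v \<bullet> v)) *\<^sub>R v\<close> has inner
      product \<open>c\<close> with \<open>v\<close>.\<close>
    have "c *\<^sub>R v \<in> range (\<lambda>x. (v \<bullet> x) *\<^sub>R v)" for c
      using assms by (intro image_eqI[where x = "(c / (v \<bullet> v)) *\<^sub>R v"]) auto
    then show ?thesis
      by (auto simp: outer_square_mult_vec span_singleton)
  qed
  then show ?thesis
    using assms by (simp add: rank_dim_range)
qed

section \<open>Positive semidefinite forms and their cones\<close>

lemma psd_cone_symmetric: "A \<in> psd_cone \<Longrightarrow> A $ i $ j = A $ j $ i"
  unfolding psd_cone_def transpose_def by (auto simp: vec_eq_iff)

lemma psd_cone_nonneg: "A \<in> psd_cone \<Longrightarrow> 0 \<le> x \<bullet> (A *v x)"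
  by (simp add: psd_cone_def)

lemma psd_coneI:
  assumes "\<And>i j. A $ i $ j = A $ j $ i" and "\<And>x. 0 \<le> x \<bullet> (A *v x)"
  shows "A \<in> psd_cone"
  using assms by (simp add: psd_cone_def transpose_def vec_eq_iff)

lemma inner_axis_matrix_axis: "axis i 1 \<bullet> (A *v axis j (1::real)) = A $ i $ j"
  by (simp add: matrix_vector_mult_basis column_def inner_axis')

lemma psd_cone_inner_commute:
  assumes "A \<in> psd_cone"
  shows "x \<bullet> (A *v y) = y \<bullet> (A *v x)"
proof -
  have "transpose A = A"
    using assms by (simp add: psd_cone_def)
  then have "x \<bullet> (A *v y) = (A *v x) \<bullet> y"
    by (metis dot_lmul_matrix transpose_matrix_vector)
  then show ?thesis
    by (simp add: inner_commute)
qed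

text \<open>The form at \<open>x + t *\<^sub>R y\<close> is a quadratic polynomial in
  \<open>t\<close> without negative values, which bounds its discriminant; the polynomial is linear
  if the form vanishes at \<open>y\<close>, hence the two cases.\<close>

lemma psd_cone_Cauchy_Schwarz:
  assumes A: "A \<in> psd_cone"
  shows "(x \<bullet> (A *v y))\<^sup>2 \<le> (x \<bullet> (A *v x)) * (y \<bullet> (A *v y))"
proof -
  define a b c where "a = x \<bullet> (A *v x)" and "b = x \<bullet> (A *v y)" and "c = y \<bullet> (A *v y)"
  have quad: "0 \<le> a + 2 * t * b + t\<^sup>2 * c" for t
  proof -
    have "0 \<le> (x + t *\<^sub>R y) \<bullet> (A *v (x + t *\<^sub>R y))"
      using A by (rule psd_cone_nonneg)
    also have "\<dots> = a + 2 * t * b + t\<^sup>2 * c"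
      using psd_cone_inner_commute[OF A, of y x]
      by (simp add: a_def b_def c_def matrix_vector_right_distrib matrix_vector_mult_scaleR
          inner_simps algebra_simps power2_eq_square)
    finally show ?thesis .
  qed
  have "b\<^sup>2 \<le> a * c"
  proof (cases "c = 0")
    case True
    have "b = 0"
    proof (rule ccontr)
      assume "b \<noteq> 0"
      \<comment> \<open>With \<open>c = 0\<close>, the polynomial takes the value \<open>-1\<close>
        at this \<open>t\<close>.\<close>
      with quad[of "- (a + 1) / (2 * b)"] True show False
        by (simp add: field_simps)
    qed
    with True show ?thesis by simp
  next
    case False
    then have "c > 0"
      using psd_cone_nonneg[OF A, of y] by (simp add: c_def)
    \<comment> \<open>The minimum is attained here and equals
      \<open>a - b\<^sup>2 / c\<close>.\<close>
    with quad[of "- b / c"] show ?thesis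
      by (simp add: field_simps power2_eq_square)
  qed
  then show ?thesis
    by (simp add: a_def b_def c_def)
qed

text \<open>Cauchy-Schwarz for \<open>A *v x\<close> and \<open>x\<close> bounds the fourth power of
  the norm of \<open>A *v x\<close> by a product with the factor
  \<open>x \<bullet> (A *v x)\<close>.\<close>

lemma psd_cone_mult_vec_eq_0:
  assumes "A \<in> psd_cone" and "x \<bullet> (A *v x) = 0"
  shows "A *v x = 0"
  using psd_cone_Cauchy_Schwarz[OF assms(1), of "A *v x" x] assms(2) by simp

lemma psd_cone_zero_diagonal:
  assumes "A \<in> psd_cone" and "A $ k $ k = 0"
  shows "A $ i $ k = 0"
proof -
  have "A *v axis k 1 = 0"
    using assms by (intro psd_cone_mult_vec_eq_0) (simp_all add: inner_axis_matrix_axis)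
  then show ?thesis
    by (metis inner_axis_matrix_axis inner_zero_right)
qed

lemma convex_cone_psd_cone: "convex_cone (psd_cone :: (real^'m^'m::finite) set)"
  unfolding convex_cone_iff
  by (auto simp: psd_cone_symmetric psd_cone_nonneg matrix_vector_mult_add_rdistrib inner_simps
      scaleR_matrix_vector_assoc[symmetric] intro!: psd_coneI)

lemma convex_cone_psd_cone_on: "convex_cone (psd_cone_on F)"
  using convex_cone_psd_cone unfolding convex_cone_iff psd_cone_on_def by auto

lemma psd_cone_on_0: "0 \<in> psd_cone_on F"
  using convex_cone_psd_cone_on by (rule convex_cone_contains_0)

lemma outer_square_in_psd_cone: "outer_square v \<in> psd_cone"
  by (intro psd_coneI)
    (simp_all add: outer_square_mult_vec inner_commute[of v] mult.commute)

lemma outer_square_in_psd_cone_on: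
  "(\<And>i. i \<notin> F \<Longrightarrow> v $ i = 0) \<Longrightarrow> outer_square v \<in> psd_cone_on F"
  by (auto simp: psd_cone_on_def outer_square_in_psd_cone)

section \<open>Schur complements and sums of squares\<close>

text \<open>One step of Cholesky elimination: \<open>v\<close> is column \<open>k\<close> divided by
  the square root of the pivot, so that \<open>outer_square v\<close> agrees with \<open>A\<close>
  in row and column \<open>k\<close>. The difference stays positive semidefinite by Cauchy-Schwarz
  against \<open>axis k 1\<close>.\<close>

lemma psd_cone_on_Schur_complement:
  assumes A: "A \<in> psd_cone_on F"
  obtains v where "\<And>i. i \<notin> F \<Longrightarrow> v $ i = 0" and "A - outer_square v \<in> psd_cone_on (F - {k})"
proof -
  have psd: "A \<in> psd_cone" and supp: "\<And>i j. \<not> (i \<in> F \<and> j \<in> F) \<Longrightarrow> A $ i $ j = 0"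
    using A by (auto simp: psd_cone_on_def)
  have sym: "A $ i $ j = A $ j $ i" for i j
    using psd by (rule psd_cone_symmetric)
  have diag: "0 \<le> A $ k $ k"
    using psd_cone_nonneg[OF psd, of "axis k 1"] by (simp add: inner_axis_matrix_axis)
  \<comment> \<open>If the pivot is zero, so is its column, and \<open>v = 0\<close> because \<open>1 / 0 = 0\<close>.\<close>
  define v where "v = (1 / sqrt (A $ k $ k)) *\<^sub>R (A *v axis k 1)"
  have v_nth: "v $ i = A $ i $ k / sqrt (A $ k $ k)" for i
    by (simp add: v_def matrix_vector_mult_basis column_def)
  have "A - outer_square v \<in> psd_cone"
  proof (rule psd_coneI)
    show "(A - outer_square v) $ i $ j = (A - outer_square v) $ j $ i" for i j
      using sym by (simp add: mult.commute)
    fix x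
    have "x \<bullet> ((A - outer_square v) *v x) = x \<bullet> (A *v x) - (x \<bullet> v)\<^sup>2"
      by (simp add: matrix_vector_mult_diff_rdistrib outer_square_mult_vec inner_simps
          inner_commute power2_eq_square)
    moreover have "(x \<bullet> v)\<^sup>2 = (x \<bullet> (A *v axis k 1))\<^sup>2 / A $ k $ k"
      using diag by (simp add: v_def power_divide)
    moreover have "(x \<bullet> (A *v axis k 1))\<^sup>2 / A $ k $ k \<le> x \<bullet> (A *v x)"
      using psd_cone_Cauchy_Schwarz[OF psd, of x "axis k 1"] diag psd_cone_nonneg[OF psd, of x]
      by (cases "A $ k $ k = 0") (simp_all add: inner_axis_matrix_axis field_simps)
    ultimately show "0 \<le> x \<bullet> ((A - outer_square v) *v x)" by linarith
  qed
  moreover have "(A - outer_square v) $ i $ j = 0" if "\<not> (i \<in> F - {k} \<and> j \<in> F - {k})" for i j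
  proof (cases "i = k \<or> j = k")
    case True
    have "A $ i $ j = v $ i * v $ j"
    proof (cases "A $ k $ k = 0")
      case zero: True
      then show ?thesis
        using True psd_cone_zero_diagonal[OF psd zero] sym by (auto simp: v_nth)
    next
      case False
      then have "sqrt (A $ k $ k) * sqrt (A $ k $ k) = A $ k $ k" "A $ k $ k \<noteq> 0"
        using diag by simp_all
      with True sym show ?thesis
        by (auto simp: v_nth)
    qed
    then show ?thesis by simp
  next
    case False
    with that have "\<not> (i \<in> F \<and> j \<in> F)" by auto
    then show ?thesis
      using supp by (auto simp: v_nth)
  qed
  ultimately have "A - outer_square v \<in> psd_cone_on (F - {k})"
    unfolding psd_cone_on_def by blast
  moreover have "v $ i = 0" if "i \<notin> F" for i
    using that supp by (simp add: v_nth)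
  ultimately show ?thesis using that by blast
qed

text \<open>The induction generalises over \<open>A\<close> because each step changes a matrix: a
  maximal non-empty face \<open>F\<close> keeps a square and passes its Schur complement to
  \<open>F - {k}\<close>, a member of \<open>D\<close> by closure under subsets. Maximality of
  \<open>F\<close> keeps \<open>D - {F}\<close> closed.\<close>

lemma psd_sum_eq_outer_square_sum:
  assumes "finite D" and "\<And>F G. F \<in> D \<Longrightarrow> G \<subseteq> F \<Longrightarrow> G \<in> D"
    and "\<And>F. F \<in> D \<Longrightarrow> A F \<in> psd_cone_on F"
  shows "\<exists>v. (\<forall>F\<in>D. \<forall>i. i \<notin> F \<longrightarrow> v F $ i = 0) \<and> (\<Sum>F\<in>D. A F) = (\<Sum>F\<in>D. outer_square (v F))"
  using assms
proof (induction D arbitrary: A rule: finite_psubset_induct)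
  case (psubset D)
  show ?case
  proof (cases "D = {}")
    case True
    then show ?thesis by simp
  next
    case False
    then obtain F where F: "F \<in> D" and max: "\<And>G. G \<in> D \<Longrightarrow> F \<subseteq> G \<Longrightarrow> F = G"
      using finite_has_maximal[OF psubset.hyps] by auto
    have smaller: "D - {F} \<subset> D"
      using F by blast
    have closed: "H \<in> D - {F}" if "G \<in> D - {F}" "H \<subseteq> G" for G H
      using that max psubset.prems(1) by auto
    have "\<exists>w B. (\<forall>i. i \<notin> F \<longrightarrow> w $ i = 0) \<and> (\<forall>G\<in>D - {F}. B G \<in> psd_cone_on G) \<and>
        (\<Sum>G\<in>D. A G) = outer_square w + (\<Sum>G\<in>D - {F}. B G)"
    proof (cases "F = {}")
      case True
      \<comment> \<open>The empty face has no smaller face to receive a remainder, but its matrix is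
        zero and leaves none.\<close>
      then have "A F = outer_square 0"
        using psubset.prems(2)[OF F] by (simp add: psd_cone_on_def vec_eq_iff)
      then show ?thesis
        using psubset.prems(2) F psubset.hyps
        by (intro exI[of _ 0] exI[of _ A]) (auto simp: sum.remove)
    next
      case False
      then obtain k where k: "k \<in> F" by blast
      obtain w where w: "\<And>i. i \<notin> F \<Longrightarrow> w $ i = 0"
        and rest: "A F - outer_square w \<in> psd_cone_on (F - {k})"
        using psd_cone_on_Schur_complement[OF psubset.prems(2)[OF F]] by blast
      define B where "B G = A G + (if G = F - {k} then A F - outer_square w else 0)" for G
      have "F - {k} \<in> D - {F}"
        using psubset.prems(1)[OF F] k by blast
      then have "(\<Sum>G\<in>D - {F}. B G) = (\<Sum>G\<in>D - {F}. A G) + (A F - outer_square w)"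
        using psubset.hyps by (simp add: B_def sum.distrib)
      then have "(\<Sum>G\<in>D. A G) = outer_square w + (\<Sum>G\<in>D - {F}. B G)"
        using psubset.hyps F by (simp add: sum.remove)
      moreover have "B G \<in> psd_cone_on G" if "G \<in> D - {F}" for G
        using that psubset.prems(2) rest
        by (auto simp: B_def intro: convex_cone_add[OF convex_cone_psd_cone_on])
      ultimately show ?thesis
        using w by blast
    qed
    then obtain w B where w: "\<And>i. i \<notin> F \<Longrightarrow> w $ i = 0"
      and B: "\<And>G. G \<in> D - {F} \<Longrightarrow> B G \<in> psd_cone_on G"
      and split: "(\<Sum>G\<in>D. A G) = outer_square w + (\<Sum>G\<in>D - {F}. B G)"
      by blast
    obtain v where v: "\<forall>G\<in>D - {F}. \<forall>i. i \<notin> G \<longrightarrow> v G $ i = 0"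
      and sum_v: "(\<Sum>G\<in>D - {F}. B G) = (\<Sum>G\<in>D - {F}. outer_square (v G))"
      using psubset.IH[OF smaller, of B] closed B by blast
    have "(\<Sum>G\<in>D - {F}. outer_square ((v(F := w)) G)) = (\<Sum>G\<in>D - {F}. outer_square (v G))"
      by (intro sum.cong) auto
    then have "(\<Sum>G\<in>D. A G) = (\<Sum>G\<in>D. outer_square ((v(F := w)) G))"
      using psubset.hyps F by (simp add: sum.remove split sum_v)
    with v w show ?thesis
      by (intro exI[of _ "v(F := w)"]) auto
  qed
qed

section \<open>The image as a Minkowski sum\<close>

text \<open>For a face \<open>F\<close>, column \<open>F\<close> of \<open>Gamma_mat\<close> is an
  arbitrary vector supported on \<open>F\<close>, and a matrix times its transpose is the sum of the
  squares of its columns.\<close>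

lemma phi_image_eq:
  "phi \<Delta> ` params \<Delta> =
    {\<Sum>F\<in>\<Delta>. outer_square (v F) | v. \<forall>F\<in>\<Delta>. \<forall>i. i \<notin> F \<longrightarrow> v F $ i = 0}"
proof -
  have phi_eq: "phi \<Delta> \<gamma> = (\<Sum>F\<in>\<Delta>. outer_square (v F))"
    if "\<And>F i. F \<in> \<Delta> \<Longrightarrow> v F $ i = (if i \<in> F then \<gamma> F i else 0)" for \<gamma> v
  proof -
    have "phi \<Delta> \<gamma> $ i $ j = (\<Sum>F\<in>\<Delta>. outer_square (v F)) $ i $ j" for i j
      unfolding phi_nth sum_component outer_square_nth
      by (intro sum.mono_neutral_cong_left) (auto simp: that)
    then show ?thesis
      by (simp add: vec_eq_iff)
  qed
  show ?thesis
  proof (intro equalityI subsetI)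
    fix A assume "A \<in> phi \<Delta> ` params \<Delta>"
    then obtain \<gamma> where "A = phi \<Delta> \<gamma>" by blast
    then show "A \<in> {\<Sum>F\<in>\<Delta>. outer_square (v F) | v. \<forall>F\<in>\<Delta>. \<forall>i. i \<notin> F \<longrightarrow> v F $ i = 0}"
      using phi_eq[of "\<lambda>F. \<chi> i. if i \<in> F then \<gamma> F i else 0" \<gamma>]
      by (intro CollectI exI[of _ "\<lambda>F. \<chi> i. if i \<in> F then \<gamma> F i else 0"]) simp
  next
    fix A assume "A \<in> {\<Sum>F\<in>\<Delta>. outer_square (v F) | v. \<forall>F\<in>\<Delta>. \<forall>i. i \<notin> F \<longrightarrow> v F $ i = 0}"
    then obtain v where v: "\<forall>F\<in>\<Delta>. \<forall>i. i \<notin> F \<longrightarrow> v F $ i = 0"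
      and A: "A = (\<Sum>F\<in>\<Delta>. outer_square (v F))" by blast
    \<comment> \<open>The restricted abstractions yield \<open>undefined\<close> outside
      \<open>i \<in> F \<in> \<Delta>\<close>, as membership in \<open>params\<close>
      demands.\<close>
    define \<gamma> where "\<gamma> = (\<lambda>F\<in>\<Delta>. \<lambda>i\<in>F. v F $ i)"
    have "\<gamma> \<in> params \<Delta>"
      by (simp add: \<gamma>_def params_def)
    moreover have "A = phi \<Delta> \<gamma>"
      unfolding A using v by (intro phi_eq[symmetric]) (auto simp: \<gamma>_def)
    ultimately show "A \<in> phi \<Delta> ` params \<Delta>" by blast
  qed
qed

text \<open>The content lies in the inclusion from right to left, where summands of any rank must be
  traded for one square per face.\<close>

lemma phi_image_eq_Minkowski_sum:
  assumes "abstract_simplicial_complex \<Delta>"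
  shows "phi \<Delta> ` params \<Delta> = (\<Sum>F\<in>\<Delta>. psd_cone_on F)"
proof (intro equalityI subsetI)
  fix A assume "A \<in> phi \<Delta> ` params \<Delta>"
  then show "A \<in> (\<Sum>F\<in>\<Delta>. psd_cone_on F)"
    unfolding phi_image_eq set_sum_alt[OF finite]
    by (fastforce intro: outer_square_in_psd_cone_on)
next
  fix A assume "A \<in> (\<Sum>F\<in>\<Delta>. psd_cone_on F)"
  then obtain B where B: "\<forall>F\<in>\<Delta>. B F \<in> psd_cone_on F" and A: "A = (\<Sum>F\<in>\<Delta>. B F)"
    unfolding set_sum_alt[OF finite] by blast
  have "G \<in> \<Delta>" if "F \<in> \<Delta>" "G \<subseteq> F" for F G
    using that assms by (auto simp: abstract_simplicial_complex_def)
  then show "A \<in> phi \<Delta> ` params \<Delta>"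
    unfolding phi_image_eq using psd_sum_eq_outer_square_sum[of \<Delta> B] B A by auto
qed

lemma convex_cone_set_sum:
  assumes "finite I" and "\<And>i. i \<in> I \<Longrightarrow> convex_cone (S i)"
  shows "convex_cone (\<Sum>i\<in>I. S i)"
  using assms
proof (induction I rule: finite_induct)
  case empty
  then show ?case by (simp add: convex_cone_iff)
next
  case (insert i I)
  \<comment> \<open>This is the form in which \<open>convex_cone_sums\<close> expresses a Minkowski
    sum.\<close>
  have "S i + sum S I = (\<Union>x\<in>S i. \<Union>y\<in>sum S I. {x + y})"
    by (auto simp: set_plus_def)
  with insert show ?case
    by (simp add: convex_cone_sums)
qed

lemma psd_cone_on_subset_phi_image:
  assumes "abstract_simplicial_complex \<Delta>" and "F \<in> \<Delta>"
  shows "psd_cone_on F \<subseteq> phi \<Delta> ` params \<Delta>"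
proof
  fix A :: "real^'a^'a" assume A: "A \<in> psd_cone_on F"
  have "A = (\<Sum>G\<in>\<Delta>. if G = F then A else 0)"
    using assms(2) by simp
  then show "A \<in> phi \<Delta> ` params \<Delta>"
    unfolding phi_image_eq_Minkowski_sum[OF assms(1)] set_sum_alt[OF finite]
    using A psd_cone_on_0 by (intro CollectI exI[of _ "\<lambda>G. if G = F then A else 0"]) auto
qed

section \<open>Rays and extreme rays\<close>

lemma ray_scaleR:
  assumes "c > 0"
  shows "ray (c *\<^sub>R x) = ray x"
proof (intro equalityI subsetI)
  fix y assume "y \<in> ray x"
  then obtain d where "d \<ge> 0" "y = d *\<^sub>R x" by (auto simp: ray_def)
  with assms show "y \<in> ray (c *\<^sub>R x)"
    unfolding ray_def by (intro CollectI exI[of _ "d / c"]) auto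
next
  fix y assume "y \<in> ray (c *\<^sub>R x)"
  with assms show "y \<in> ray x"
    unfolding ray_def by auto
qed

lemma ray_self: "x \<in> ray x"
  unfolding ray_def by (intro CollectI exI[of _ 1]) simp

lemma ray_eq_rayI:
  assumes "A \<in> ray z" and "A \<noteq> 0"
  shows "ray z = ray A"
proof -
  obtain c where "c \<ge> 0" "A = c *\<^sub>R z"
    using assms(1) by (auto simp: ray_def)
  moreover from this assms(2) have "c > 0"
    by (cases "c = 0") auto
  ultimately show ?thesis
    by (simp add: ray_scaleR)
qed

lemma extreme_ray_elementD:
  assumes "extreme_ray_of C R" and "A \<in> R" and "A \<noteq> 0"
  shows "R = ray A"
  using assms ray_eq_rayI by (auto simp: extreme_ray_of_def rays_of_def)

text \<open>
  If \<open>A\<close> has rank one then \<open>ker A\<close> is a hyperplane, and \<open>c X \<le> A\<close> with \<open>c > 0\<close> forces \<open>ker A \<subseteq> ker X\<close>, so that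
  \<open>X\<close> is determined by \<open>A\<close> up to a scalar.
\<close>

lemma psd_dominated_by_rank_one:
  assumes A: "A \<in> psd_cone" and rank: "rank A = 1" and X: "X \<in> psd_cone" "X \<noteq> 0"
    and dom: "\<And>z. c * (z \<bullet> (X *v z)) \<le> z \<bullet> (A *v z)" and c: "c > 0"
  shows "ray X = ray A"
proof -
  have "A \<noteq> 0"
    using rank by (auto simp: rank_dim_range)
  then obtain i j where "A $ i $ j \<noteq> 0"
    by (auto simp: vec_eq_iff)
  then obtain k where k: "A $ k $ k \<noteq> 0"
    using psd_cone_zero_diagonal[OF A] by metis
  define u where "u = A *v axis k 1"
  have u_nth: "u $ i = A $ i $ k" for i
    by (simp add: u_def matrix_vector_mult_basis column_def)
  have "u \<noteq> 0"
    using k u_nth[of k] by auto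
  \<comment> \<open>The range has dimension one and contains \<open>u \<noteq> 0\<close>.\<close>
  have "range (\<lambda>x. A *v x) \<subseteq> span {u}"
    using \<open>u \<noteq> 0\<close> rank by (intro card_ge_dim_independent) (auto simp: u_def rank_dim_range)
  then have "\<exists>t. A *v x = t *\<^sub>R u" for x
    by (auto simp: span_singleton)
  then have Ax: "A *v x = ((A *v x) $ k / A $ k $ k) *\<^sub>R u" for x
    using k u_nth[of k] by (metis nonzero_eq_divide_eq real_scaleR_def vector_scaleR_component)
  \<comment> \<open>Such a \<open>Y\<close> is determined by \<open>Y $ k $ k\<close> and row
    \<open>k\<close> of \<open>A\<close>. Comparing the cases \<open>Y = X\<close> and
    \<open>Y = A\<close> then shows that \<open>X\<close> is a multiple of \<open>A\<close>.\<close>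
  have form: "Y $ p $ q = Y $ k $ k / (A $ k $ k)\<^sup>2 * (A $ k $ p * A $ k $ q)"
    if Y: "Y \<in> psd_cone" and ker: "\<And>z. A *v z = 0 \<Longrightarrow> Y *v z = 0" for Y p q
  proof -
    have col: "Y $ p $ q = A $ k $ q / A $ k $ k * Y $ p $ k" for p q
    proof -
      define t where "t = A $ k $ q / A $ k $ k"
      have "(A *v axis q 1) $ k = A $ k $ q"
        by (simp add: matrix_vector_mult_basis column_def)
      \<comment> \<open>Column \<open>q\<close> of \<open>A\<close> is \<open>t\<close> times column
        \<open>k\<close>; the inclusion of kernels transfers this relation to the columns of
        \<open>Y\<close>.\<close>
      then have "A *v (axis q 1 - t *\<^sub>R axis k 1) = 0"
        using Ax[of "axis q 1"]
        by (simp add: matrix_vector_mult_diff_distrib matrix_vector_mult_scaleR u_def t_def)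
      then have "Y *v (axis q 1 - t *\<^sub>R axis k 1) = 0"
        by (rule ker)
      then have "(Y *v axis q 1) $ p = t * (Y *v axis k 1) $ p"
        by (simp add: matrix_vector_mult_diff_distrib matrix_vector_mult_scaleR)
      then show ?thesis
        by (simp add: matrix_vector_mult_basis column_def t_def)
    qed
    \<comment> \<open>By symmetry the column relation also holds for rows, which reduces
      \<open>Y $ p $ k\<close> to \<open>Y $ k $ k\<close>.\<close>
    show ?thesis
      using col[of p q] col[of k p] psd_cone_symmetric[OF Y, of p k]
      by (simp add: power2_eq_square)
  qed
  have ker: "X *v z = 0" if "A *v z = 0" for z
  proof -
    have "c * (z \<bullet> (X *v z)) \<le> 0"
      using dom[of z] that by simp
    then have "z \<bullet> (X *v z) = 0"
      using c psd_cone_nonneg[OF X(1), of z] by (simp add: mult_le_0_iff)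
    then show ?thesis
      by (rule psd_cone_mult_vec_eq_0[OF X(1)])
  qed
  define s where "s = X $ k $ k / A $ k $ k"
  have XA: "X = s *\<^sub>R A"
  proof -
    have "X $ p $ q = s * A $ p $ q" for p q
    proof -
      have "X $ p $ q = X $ k $ k / (A $ k $ k)\<^sup>2 * (A $ k $ p * A $ k $ q)"
        using X(1) ker by (rule form)
      moreover have "A $ p $ q = A $ k $ k / (A $ k $ k)\<^sup>2 * (A $ k $ p * A $ k $ q)"
        using A by (rule form)
      ultimately show ?thesis
        by (simp add: s_def power2_eq_square)
    qed
    then show ?thesis
      by (simp add: vec_eq_iff)
  qed
  have "0 \<le> s"
    using psd_cone_nonneg[OF X(1), of "axis k 1"] psd_cone_nonneg[OF A, of "axis k 1"]
    by (simp add: inner_axis_matrix_axis s_def)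
  moreover have "s \<noteq> 0"
    using X(2) XA by auto
  ultimately show ?thesis
    unfolding XA by (intro ray_scaleR) simp
qed

text \<open>If \<open>a *\<^sub>R X + b *\<^sub>R Y\<close> spans \<open>ray A\<close>, then
  \<open>A\<close> dominates a positive multiple of each of \<open>X\<close> and \<open>Y\<close>.
  Both therefore span \<open>ray A\<close> and cannot lie on distinct rays.\<close>

lemma rank_one_imp_extreme_ray:
  assumes A: "A \<in> C" and C: "C \<subseteq> psd_cone" and rank: "rank A = 1"
  shows "extreme_ray_of C (ray A)"
proof -
  have "A \<noteq> 0"
    using rank by (auto simp: rank_dim_range)
  have dominated: "ray X = ray A"
    if X: "X \<in> C - {0}" and Y: "Y \<in> C - {0}" and ab: "a > 0" "b > 0"
      and eq: "ray A = ray (a *\<^sub>R X + b *\<^sub>R Y)" for X Y a b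
  proof -
    obtain c where c: "c \<ge> 0" "A = c *\<^sub>R (a *\<^sub>R X + b *\<^sub>R Y)"
      using ray_self[of A] unfolding eq by (auto simp: ray_def)
    with \<open>A \<noteq> 0\<close> have "c > 0"
      by (cases "c = 0") auto
    have psd: "X \<in> psd_cone" "Y \<in> psd_cone" "A \<in> psd_cone"
      using X Y A C by auto
    show ?thesis
    proof (rule psd_dominated_by_rank_one[OF psd(3) rank psd(1)])
      show "X \<noteq> 0" using X by simp
      show "c * a > 0" using \<open>c > 0\<close> ab by simp
      fix z
      have "z \<bullet> (A *v z) = c * a * (z \<bullet> (X *v z)) + c * b * (z \<bullet> (Y *v z))"
        by (simp add: c(2) matrix_vector_mult_add_rdistrib scaleR_matrix_vector_assoc[symmetric]
            inner_simps algebra_simps)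
      then show "c * a * (z \<bullet> (X *v z)) \<le> z \<bullet> (A *v z)"
        using \<open>c > 0\<close> ab psd_cone_nonneg[OF psd(2), of z] by simp
    qed
  qed
  have "ray X = ray Y"
    if "X \<in> C - {0}" "Y \<in> C - {0}" "a > 0" "b > 0" "ray A = ray (a *\<^sub>R X + b *\<^sub>R Y)" for X Y a b
    \<comment> \<open>The second use of \<open>dominated\<close> exchanges \<open>X\<close> with
      \<open>Y\<close> and \<open>a\<close> with \<open>b\<close>.\<close>
    using dominated[OF that] dominated[OF that(2,1,4,3)] that(5) by (simp add: add.commute)
  then show ?thesis
    using A \<open>A \<noteq> 0\<close> unfolding extreme_ray_of_def rays_of_def by blast
qed

text \<open>A generator of the ray is a sum of squares. Once a non-zero square is split off,
  extremality forces the remaining sum to vanish or to lie on the ray of that square, so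
  \<open>A\<close> is a multiple of it.\<close>

lemma extreme_ray_imp_rank_one:
  assumes complex: "abstract_simplicial_complex \<Delta>"
    and ext: "extreme_ray_of (phi \<Delta> ` params \<Delta>) R" and A: "A \<in> R" "A \<noteq> 0"
  shows "rank A = 1 \<and> (\<exists>F\<in>\<Delta>. A \<in> psd_cone_on F)"
proof -
  let ?C = "phi \<Delta> ` params \<Delta>"
  have R: "R = ray A"
    using ext A by (rule extreme_ray_elementD)
  obtain z where z: "z \<in> ?C" "z \<noteq> 0" "R = ray z"
    using ext by (auto simp: extreme_ray_of_def rays_of_def)
  then obtain v where v: "\<forall>F\<in>\<Delta>. \<forall>i. i \<notin> F \<longrightarrow> v F $ i = 0"
    and z_sum: "z = (\<Sum>F\<in>\<Delta>. outer_square (v F))"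
    unfolding phi_image_eq by blast
  obtain F where F: "F \<in> \<Delta>" and vF: "v F \<noteq> 0"
    using z(2) unfolding z_sum by (metis outer_square_eq_0_iff sum.neutral)
  define X Y where "X = outer_square (v F)" and "Y = (\<Sum>G\<in>\<Delta> - {F}. outer_square (v G))"
  have z_eq: "z = X + Y"
    using F by (simp add: z_sum X_def Y_def sum.remove)
  have "X \<in> psd_cone_on F"
    unfolding X_def using v F by (intro outer_square_in_psd_cone_on) auto
  then have X: "X \<in> ?C - {0}"
    using psd_cone_on_subset_phi_image[OF complex F] vF outer_square_eq_0_iff
    unfolding X_def by blast
  have Y: "Y \<in> ?C"
  proof -
    \<comment> \<open>Giving \<open>F\<close> the zero vector turns \<open>Y\<close> into a sum over
      all of \<open>\<Delta>\<close>, the shape of a point of the image.\<close>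
    have "Y = (\<Sum>G\<in>\<Delta> - {F}. outer_square ((v(F := 0)) G))"
      unfolding Y_def by (intro sum.cong) auto
    also have "\<dots> = (\<Sum>G\<in>\<Delta>. outer_square ((v(F := 0)) G))"
      by (intro sum.mono_neutral_left) (auto simp: outer_square_eq_0_iff)
    finally show ?thesis
      unfolding phi_image_eq using v by (intro CollectI exI[of _ "v(F := 0)"]) auto
  qed
  have "ray A = ray X"
  proof (cases "Y = 0")
    case True
    then show ?thesis using R z(3) z_eq by simp
  next
    case False
    have "R = ray (1 *\<^sub>R X + 1 *\<^sub>R Y)"
      using z(3) z_eq by simp
    then have "ray X = ray Y"
      using ext X Y False unfolding extreme_ray_of_def by (metis Diff_iff singletonD zero_less_one)
    then obtain c where "c \<ge> 0" "Y = c *\<^sub>R X"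
      using ray_self[of Y] by (auto simp: ray_def)
    then have "z = (1 + c) *\<^sub>R X" "1 + c > 0"
      by (simp_all add: z_eq algebra_simps)
    then show ?thesis
      using R z(3) ray_scaleR by metis
  qed
  then obtain c where c: "c \<ge> 0" "A = c *\<^sub>R X"
    using ray_self[of A] by (auto simp: ray_def)
  then have A_eq: "A = outer_square (sqrt c *\<^sub>R v F)"
    by (simp add: X_def outer_square_scaleR)
  then have "sqrt c *\<^sub>R v F \<noteq> 0"
    using A(2) outer_square_eq_0_iff by blast
  then have "rank A = 1"
    unfolding A_eq by (rule rank_outer_square)
  moreover have "A \<in> psd_cone_on F"
    unfolding A_eq using v F by (intro outer_square_in_psd_cone_on) auto
  ultimately show ?thesis
    using F by blast
qed

theorem theorem2p1:
  fixes \<Delta> :: "'m::finite set set"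
  assumes "abstract_simplicial_complex \<Delta>"
  shows "convex_cone (phi \<Delta> ` params \<Delta>) \<and>
    {A. A \<noteq> 0 \<and> (\<exists>R. extreme_ray_of (phi \<Delta> ` params \<Delta>) R \<and> A \<in> R)} =
      {A. rank A = 1 \<and> (\<exists>F\<in>\<Delta>. A \<in> psd_cone_on F)} \<and>
    phi \<Delta> ` params \<Delta> = (\<Sum>F\<in>\<Delta>. psd_cone_on F)"
proof (intro conjI equalityI subsetI)
  show "convex_cone (phi \<Delta> ` params \<Delta>)"
    unfolding phi_image_eq_Minkowski_sum[OF assms]
    by (intro convex_cone_set_sum convex_cone_psd_cone_on finite)
next
  fix A assume "A \<in> {A. A \<noteq> 0 \<and> (\<exists>R. extreme_ray_of (phi \<Delta> ` params \<Delta>) R \<and> A \<in> R)}"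
  then show "A \<in> {A. rank A = 1 \<and> (\<exists>F\<in>\<Delta>. A \<in> psd_cone_on F)}"
    using extreme_ray_imp_rank_one[OF assms] by blast
next
  fix A :: "real^'m^'m" assume "A \<in> {A. rank A = 1 \<and> (\<exists>F\<in>\<Delta>. A \<in> psd_cone_on F)}"
  then have rank: "rank A = 1" and "A \<in> phi \<Delta> ` params \<Delta>"
    using psd_cone_on_subset_phi_image[OF assms] by auto
  then have "extreme_ray_of (phi \<Delta> ` params \<Delta>) (ray A)"
    using phi_in_psd_cone by (intro rank_one_imp_extreme_ray) auto
  moreover have "A \<noteq> 0"
    using rank by (auto simp: rank_dim_range)
  ultimately show "A \<in> {A. A \<noteq> 0 \<and> (\<exists>R. extreme_ray_of (phi \<Delta> ` params \<Delta>) R \<and> A \<in> R)}"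
    using ray_self by blast
\<comment> \<open>The initial method also splits the last conjunct, whose two inclusions
  remain.\<close>
qed (use phi_image_eq_Minkowski_sum[OF assms] in auto)

end
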